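(* Let $P_n$ be the path on $n\ge 2$ vertices and let $N_{\rm esp}(P_n)$ be the number of end super dominating sets of $P_n$ of minimum cardinality. Then, writing $n$ in terms of an integer $k\ge 0$, $$N_{\rm esp}(P_n)=\begin{cases}1 & \text{if } n=4k,\\ 2k+1 & \text{if } n=4k+1,\\ \dfrac{5k^2+5k+2}{2} & \text{if } n=4k+2,\\ k+1 & \text{if } n=4k+3.\end{cases}$$
   Context: Graphs are finite, simple and undirected. For a graph $G=(V,E)$ and $S\subseteq V$, write $\overline{S}=V\setminus S$, and let $N(v)$ be the open neighbourhood of $v$. A set $S \subseteq V$ is an end super dominating set (ESD-set) of $G$ if for every $u\in\overline{S}$ there exists $v\in S$ with $N(v)\cap\overline{S}=\{u\}$, and moreover $\deg(u)\ge 2$ for every $u\in\overline{S}$. The end super domination number $\gamma_{\rm esp}(G)$ is the minimum cardinality of an ESD-set of $G$, and $N_{\rm esp}(G)$ is the number of distinct ESD-sets $S\subseteq V$ of $G$ with $|S|=\gamma_{\rm esp}(G)$ (counted as subsets of the labelled vertex set, not up to symmetry). *)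

theory Defs
  imports Complex_Main
begin

text \<open>A graph is a pair of a vertex set and a set of edges, each edge being a two-element set
  of vertices.\<close>

type_synonym 'a graph = "'a set \<times> 'a set set"

abbreviation verts :: "'a graph \<Rightarrow> 'a set" where
  "verts G \<equiv> fst G"

abbreviation edges :: "'a graph \<Rightarrow> 'a set set" where
  "edges G \<equiv> snd G"

definition finite_simple_graph :: "'a graph \<Rightarrow> bool" where
  "finite_simple_graph G \<longleftrightarrow>
     finite (verts G) \<and> (\<forall>e\<in>edges G. e \<subseteq> verts G \<and> card e = 2)"

definition neighbourhood :: "'a graph \<Rightarrow> 'a \<Rightarrow> 'a set" where
  "neighbourhood G v = {w \<in> verts G. {v, w} \<in> edges G}"

definition degree :: "'a graph \<Rightarrow> 'a \<Rightarrow> nat" where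
  "degree G v = card (neighbourhood G v)"

definition end_super_dominating :: "'a graph \<Rightarrow> 'a set \<Rightarrow> bool" where
  "end_super_dominating G S \<longleftrightarrow>
     S \<subseteq> verts G \<and>
     (\<forall>u \<in> verts G - S. \<exists>v\<in>S. neighbourhood G v \<inter> (verts G - S) = {u}) \<and>
     (\<forall>u \<in> verts G - S. degree G u \<ge> 2)"

definition end_super_domination_number :: "'a graph \<Rightarrow> nat" where
  "end_super_domination_number G = Min (card ` {S. end_super_dominating G S})"

definition num_min_end_super_dominating :: "'a graph \<Rightarrow> nat" where
  "num_min_end_super_dominating G =
     card {S. end_super_dominating G S \<and> card S = end_super_domination_number G}"

definition path_graph :: "nat \<Rightarrow> nat graph" where
  "path_graph n = ({1..n}, {{i, i + 1} | i. 1 \<le> i \<and> i < n})"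

lemma finite_simple_graph_path_graph: "finite_simple_graph (path_graph n)"
  by (auto simp: finite_simple_graph_def path_graph_def)

text \<open>The minimum in the end super domination number of a finite graph is taken over a finite
  nonempty set.\<close>

lemma end_super_dominating_verts: "end_super_dominating G (verts G)"
  by (simp add: end_super_dominating_def)

lemma finite_end_super_dominating:
  "finite_simple_graph G \<Longrightarrow> finite {S. end_super_dominating G S}"
  by (rule finite_subset[of _ "Pow (verts G)"])
    (auto simp: finite_simple_graph_def end_super_dominating_def)

end

theory Submission
  imports Defs
begin

text \<open>Encode a set by the 0-1 word of length \<open>n\<close> that marks its complement. The set is end super
  dominating iff the word is a concatenation of the tiles 0, 010, 0110 and 01010, and this tiling is
  unique. A tile of length \<open>l\<close> with \<open>m\<close> ones contributes \<open>l - 2 * m\<close>, which is 0 for 0110 and 1 for the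
  others, so minimum sets are the words with the fewest tiles other than 0110. Removing the last tile
  gives a recurrence for the number of words with a given number of ones.\<close>

text \<open>The interval \<open>{2..<n}\<close> encodes the degree condition, as the ends of the
  path have degree at most 1. The two alternatives say that the left or the right neighbour of
  \<open>u\<close> is private to \<open>u\<close>. Since \<open>n\<close> enters only through the
  interval, truncating a member gives a member for a shorter path.\<close>

definition co_esd :: "nat \<Rightarrow> nat set set" where
  "co_esd n = {T. T \<subseteq> {2..<n} \<and>
     (\<forall>u\<in>T. (u - 1 \<notin> T \<and> u - 2 \<notin> T) \<or> (u + 1 \<notin> T \<and> u + 2 \<notin> T))}"

definition num_co_esd :: "nat \<Rightarrow> nat \<Rightarrow> nat" where
  "num_co_esd n m = card {T \<in> co_esd n. card T = m}"

section \<open>From end super dominating sets of a path to their complements\<close>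

lemma neighbourhood_path_graph:
  assumes "v \<in> {1..n}"
  shows "neighbourhood (path_graph n) v = {w \<in> {1..n}. w = v + 1 \<or> v = w + 1}"
  using assms by (auto simp: neighbourhood_def path_graph_def doubleton_eq_iff)

lemma degree_path_graph_ge_2_iff:
  assumes "v \<in> {1..n}"
  shows "2 \<le> degree (path_graph n) v \<longleftrightarrow> v \<in> {2..<n}"
proof
  assume deg: "2 \<le> degree (path_graph n) v"
  show "v \<in> {2..<n}"
  proof (rule ccontr)
    assume "v \<notin> {2..<n}"
    then have "v = 1 \<or> v = n"
      using assms by auto
    then have "neighbourhood (path_graph n) v \<subseteq> {v + 1} \<or>
        neighbourhood (path_graph n) v \<subseteq> {v - 1}"
      unfolding neighbourhood_path_graph[OF assms] by auto
    then have "degree (path_graph n) v \<le> 1"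
      unfolding degree_def by (auto dest: card_mono[rotated])
    with deg show False by simp
  qed
next
  assume v: "v \<in> {2..<n}"
  then have "neighbourhood (path_graph n) v = {v - 1, v + 1}"
    unfolding neighbourhood_path_graph[OF assms] by auto
  then show "2 \<le> degree (path_graph n) v"
    by (simp add: degree_def)
qed

text \<open>Only \<open>u - 1\<close> and \<open>u + 1\<close> can serve as \<open>v\<close>, and
  their other neighbours are \<open>u - 2\<close> and \<open>u + 2\<close>. When one of these falls
  off the path it is not in \<open>T\<close> either, so the ends need no separate case.\<close>

lemma private_neighbour_path_graph_iff:
  assumes T: "T \<subseteq> {2..<n}" and u: "u \<in> T"
  shows "(\<exists>v\<in>{1..n} - T. neighbourhood (path_graph n) v \<inter> T = {u}) \<longleftrightarrow>
    (u - 1 \<notin> T \<and> u - 2 \<notin> T) \<or> (u + 1 \<notin> T \<and> u + 2 \<notin> T)"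
    (is "?L \<longleftrightarrow> ?R")
proof
  assume ?L
  then obtain v where v: "v \<in> {1..n}" "v \<notin> T"
    and N: "{w \<in> {1..n}. w = v + 1 \<or> v = w + 1} \<inter> T = {u}"
    using neighbourhood_path_graph by (metis DiffE)
  have uv: "u = v + 1 \<or> v = u + 1"
    using N by auto
  have other: "w = u" if "w \<in> T" "w = v + 1 \<or> v = w + 1" for w
    using N T that by fastforce
  show ?R
    using uv
  proof
    assume "u = v + 1"
    \<comment> \<open>Here \<open>v - 1\<close> is \<open>u - 2\<close>; if it were in
      \<open>T\<close>, \<open>other\<close> would force it to equal \<open>v + 1\<close>.\<close>
    moreover have "v - 1 \<notin> T"
      using other[of "v - 1"] T v calculation by fastforce
    ultimately show ?R
      using v by simp
  next
    assume "v = u + 1"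
    then show ?R
      using other[of "u + 2"] v by auto
  qed
next
  have u2: "2 \<le> u" "u < n"
    using T u by auto
  assume ?R
  then show ?L
  proof
    assume a: "u - 1 \<notin> T \<and> u - 2 \<notin> T"
    have mem: "u - 1 \<in> {1..n}"
      using u2 by auto
    \<comment> \<open>This turns the truncated differences \<open>u - 1\<close> and
      \<open>u - 2\<close> into \<open>j + 1\<close> and \<open>j\<close>.\<close>
    obtain j where "u = 2 + j"
      using le_Suc_ex[OF u2(1)] by blast
    then have "neighbourhood (path_graph n) (u - 1) \<inter> T = {u}"
      unfolding neighbourhood_path_graph[OF mem] using a u u2 by auto
    with a mem show ?L by blast
  next
    assume a: "u + 1 \<notin> T \<and> u + 2 \<notin> T"
    have mem: "u + 1 \<in> {1..n}"
      using u2 by auto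
    have "neighbourhood (path_graph n) (u + 1) \<inter> T = {u}"
      unfolding neighbourhood_path_graph[OF mem] using a u u2 by auto
    with a mem show ?L by blast
  qed
qed

lemma end_super_dominating_path_graph_iff:
  assumes "S \<subseteq> {1..n}"
  shows "end_super_dominating (path_graph n) S \<longleftrightarrow> {1..n} - S \<in> co_esd n"
proof -
  define T where "T = {1..n} - S"
  have S: "S = {1..n} - T" and T1: "T \<subseteq> {1..n}"
    using assms by (auto simp: T_def)
  have verts: "verts (path_graph n) = {1..n}"
    by (simp add: path_graph_def)
  have "end_super_dominating (path_graph n) S \<longleftrightarrow>
      (\<forall>u\<in>T. \<exists>v\<in>{1..n} - T. neighbourhood (path_graph n) v \<inter> T = {u}) \<and>
      (\<forall>u\<in>T. 2 \<le> degree (path_graph n) u)"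
    using assms unfolding end_super_dominating_def verts T_def[symmetric] S[symmetric] by simp
  also have "(\<forall>u\<in>T. 2 \<le> degree (path_graph n) u) \<longleftrightarrow> T \<subseteq> {2..<n}"
    using T1 degree_path_graph_ge_2_iff by blast
  finally have esd: "end_super_dominating (path_graph n) S \<longleftrightarrow>
      (\<forall>u\<in>T. \<exists>v\<in>{1..n} - T. neighbourhood (path_graph n) v \<inter> T = {u}) \<and> T \<subseteq> {2..<n}" .
  have "(\<forall>u\<in>T. \<exists>v\<in>{1..n} - T. neighbourhood (path_graph n) v \<inter> T = {u}) \<longleftrightarrow>
      (\<forall>u\<in>T. (u - 1 \<notin> T \<and> u - 2 \<notin> T) \<or> (u + 1 \<notin> T \<and> u + 2 \<notin> T))" if "T \<subseteq> {2..<n}"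
    using private_neighbour_path_graph_iff[OF that] by (rule ball_cong[OF refl])
  with esd show ?thesis
    unfolding co_esd_def T_def[symmetric] mem_Collect_eq by argo
qed

lemma co_esd_subset: "T \<in> co_esd n \<Longrightarrow> T \<subseteq> {2..<n}"
  by (simp add: co_esd_def)

lemma finite_co_esd: "finite (co_esd n)"
  by (rule finite_subset[of _ "Pow {2..<n}"]) (auto dest: co_esd_subset)

lemma num_co_esd_eq_0_iff: "num_co_esd n m = 0 \<longleftrightarrow> (\<forall>T\<in>co_esd n. card T \<noteq> m)"
  by (auto simp: num_co_esd_def finite_co_esd)

text \<open>Complementation in \<open>{1..n}\<close> matches minimum sets with members of
  \<open>co_esd n\<close> of maximum size, so it remains to find the largest \<open>M\<close> with a
  nonzero count and to evaluate that count.\<close>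

lemma num_min_esd_path_graph_eq:
  assumes pos: "num_co_esd n M > 0" and max: "\<And>m. m > M \<Longrightarrow> num_co_esd n m = 0"
  shows "num_min_end_super_dominating (path_graph n) = num_co_esd n M"
proof -
  define V where "V = {1..n}"
  let ?esd = "end_super_dominating (path_graph n)"
  have iff: "?esd S \<longleftrightarrow> V - S \<in> co_esd n" if "S \<subseteq> V" for S
    using end_super_dominating_path_graph_iff that unfolding V_def .
  have sub: "S \<subseteq> V" if "?esd S" for S
    using that by (simp add: end_super_dominating_def path_graph_def V_def)
  have cosub: "T \<subseteq> V" if "T \<in> co_esd n" for T
    using co_esd_subset[OF that] by (auto simp: V_def)
  have le: "card T \<le> M" if "T \<in> co_esd n" for T
    using max[of "card T"] that num_co_esd_eq_0_iff not_le by blast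
  obtain T0 where T0: "T0 \<in> co_esd n" "card T0 = M"
    using pos num_co_esd_eq_0_iff[of n M] by auto
  have "finite V" "card V = n"
    by (simp_all add: V_def)
  then have card_compl: "card (V - X) = n - card X" and card_le: "card X \<le> n" if "X \<subseteq> V" for X
    using that by (auto simp: card_Diff_subset finite_subset dest: card_mono[rotated])
  have compl_compl: "V - (V - X) = X" if "X \<subseteq> V" for X
    using that by auto
  have esd_compl: "?esd (V - T)" if "T \<in> co_esd n" for T
    using that iff[of "V - T"] by (simp add: compl_compl cosub)
  \<comment> \<open>This makes \<open>n - M\<close> an exact difference, so that a set of this size
    has a complement of size \<open>M\<close>.\<close>
  have M: "M \<le> n"
    using card_le[OF cosub[OF T0(1)]] T0(2) by simp
  have "end_super_domination_number (path_graph n) = n - M"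
    unfolding end_super_domination_number_def
  proof (rule Min_eqI)
    show "finite (card ` {S. ?esd S})"
      using finite_end_super_dominating finite_simple_graph_path_graph by blast
  next
    fix y assume "y \<in> card ` {S. ?esd S}"
    then obtain S where S: "?esd S" "y = card S"
      by auto
    then have "card (V - S) \<le> M"
      using le iff sub by blast
    then show "n - M \<le> y"
      using card_compl[OF sub[OF S(1)]] S(2) by simp
  next
    show "n - M \<in> card ` {S. ?esd S}"
      using card_compl[OF cosub[OF T0(1)]] T0 esd_compl
      by (intro image_eqI[of _ _ "V - T0"]) auto
  qed
  moreover have "bij_betw (\<lambda>S. V - S) {S. ?esd S \<and> card S = n - M} {T \<in> co_esd n. card T = M}"
  proof (rule bij_betw_byWitness[where f' = "\<lambda>T. V - T"])
    show "(\<lambda>S. V - S) ` {S. ?esd S \<and> card S = n - M} \<subseteq> {T \<in> co_esd n. card T = M}"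
    proof -
      have "V - S \<in> co_esd n \<and> card (V - S) = M" if "?esd S" "card S = n - M" for S
        using iff[OF sub[OF that(1)]] card_compl[OF sub[OF that(1)]] that M by simp
      then show ?thesis by blast
    qed
    show "(\<lambda>T. V - T) ` {T \<in> co_esd n. card T = M} \<subseteq> {S. ?esd S \<and> card S = n - M}"
    proof -
      have "?esd (V - T) \<and> card (V - T) = n - M" if "T \<in> co_esd n" "card T = M" for T
        using esd_compl card_compl[OF cosub[OF that(1)]] that by simp
      then show ?thesis by blast
    qed
  qed (use sub cosub compl_compl in blast)+
  ultimately show ?thesis
    unfolding num_min_end_super_dominating_def num_co_esd_def by (simp add: bij_betw_same_card)
qed

section \<open>Recurrence by removal of the last tile\<close>

text \<open>The four families are the words of length \<open>n + 5\<close> whose last tile is 0,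
  010, 0110 or 01010, in this order. The shift by 5 is the length of the longest tile.\<close>

lemma co_esd_rec:
  "co_esd (n + 5) = co_esd (n + 4) \<union> insert (n + 4) ` co_esd (n + 2)
     \<union> (\<lambda>T. insert (n + 4) (insert (n + 3) T)) ` co_esd (n + 1)
     \<union> (\<lambda>T. insert (n + 4) (insert (n + 2) T)) ` co_esd n"
    (is "_ = ?A \<union> ?B \<union> ?C \<union> ?D")
proof (intro equalityI subsetI)
  fix T assume "T \<in> co_esd (n + 5)"
  then have sub: "T \<subseteq> {2..<n + 5}"
    and ok: "\<And>u. u \<in> T \<Longrightarrow> (u - 1 \<notin> T \<and> u - 2 \<notin> T) \<or> (u + 1 \<notin> T \<and> u + 2 \<notin> T)"
    by (auto simp: co_esd_def)
  \<comment> \<open>The condition only asks for absent elements, so it survives the removal of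
    elements.\<close>
  have restrict: "T \<inter> {..<j} \<in> co_esd j" for j
    using sub ok by (auto simp: co_esd_def)
  have split: "T = T \<inter> {..<j} \<union> (T \<inter> {j..<n + 5})" for j
    using sub by auto
  have i4: "{n + 4..<n + 5} = {n + 4}" and i2: "{n + 2..<n + 5} = {n + 2, n + 3, n + 4}"
    and i1: "{n + 1..<n + 5} = {n + 1, n + 2, n + 3, n + 4}"
    and i0: "{n..<n + 5} = {n, n + 1, n + 2, n + 3, n + 4}"
    by auto
  show "T \<in> ?A \<union> ?B \<union> ?C \<union> ?D"
  proof (cases "n + 4 \<in> T")
    case False
    then have "T = T \<inter> {..<n + 4}"
      using split[of "n + 4"] unfolding i4 by auto
    then show ?thesis
      using restrict[of "n + 4"] by auto
  next
    case t4: True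
    show ?thesis
    proof (cases "n + 3 \<in> T")
      case t3: True
      \<comment> \<open>The right alternative for \<open>n + 3\<close> fails because of
        \<open>n + 4\<close>, so the left one holds.\<close>
      then have "n + 2 \<notin> T" "n + 1 \<notin> T"
        using ok[of "n + 3"] t4 by (auto simp: eval_nat_numeral)
      then have "T = insert (n + 4) (insert (n + 3) (T \<inter> {..<n + 1}))"
        using split[of "n + 1"] t3 t4 unfolding i1 by auto
      then show ?thesis
        using restrict[of "n + 1"] by blast
    next
      case t3: False
      show ?thesis
      proof (cases "n + 2 \<in> T")
        case t2: True
        \<comment> \<open>Again \<open>n + 4\<close> rules out the right alternative, now for
          \<open>n + 2\<close>.\<close>
        then have "n + 1 \<notin> T" "n \<notin> T"
          using ok[of "n + 2"] t4 by (auto simp: eval_nat_numeral)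
        then have "T = insert (n + 4) (insert (n + 2) (T \<inter> {..<n}))"
          using split[of n] t2 t3 t4 unfolding i0 by auto
        then show ?thesis
          using restrict[of n] by blast
      next
        case False
        then have "T = insert (n + 4) (T \<inter> {..<n + 2})"
          using split[of "n + 2"] t3 t4 unfolding i2 by auto
        then show ?thesis
          using restrict[of "n + 2"] by blast
      qed
    qed
  qed
next
  fix T assume "T \<in> ?A \<union> ?B \<union> ?C \<union> ?D"
  then consider "T \<in> ?A"
    | T' where "T' \<in> co_esd (n + 2)" "T = insert (n + 4) T'"
    | T' where "T' \<in> co_esd (n + 1)" "T = insert (n + 4) (insert (n + 3) T')"
    | T' where "T' \<in> co_esd n" "T = insert (n + 4) (insert (n + 2) T')"
    by blast
  then show "T \<in> co_esd (n + 5)"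
  proof cases
    case 1
    then show ?thesis
      by (auto simp: co_esd_def)
  next
    case 2
    \<comment> \<open>In this and the next two cases the bound keeps \<open>T'\<close> at distance
      at least 3 from the new elements, and the condition looks only 2 positions away.\<close>
    have "v < n + 2" if "v \<in> T'" for v
      using co_esd_subset[OF 2(1)] that by auto
    then show ?thesis
      using 2 unfolding co_esd_def by fastforce
  next
    case 3
    have "v < n + 1" if "v \<in> T'" for v
      using co_esd_subset[OF 3(1)] that by auto
    then show ?thesis
      using 3 unfolding co_esd_def by fastforce
  next
    case 4
    have "v < n" if "v \<in> T'" for v
      using co_esd_subset[OF 4(1)] that by auto
    then show ?thesis
      using 4 unfolding co_esd_def by fastforce
  qed
qed

lemma num_co_esd_rec:
  "num_co_esd (n + 5) (m + 2) = num_co_esd (n + 4) (m + 2) + num_co_esd (n + 2) (m + 1)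
     + num_co_esd (n + 1) m + num_co_esd n m"
proof -
  let ?E = "\<lambda>n m. {T \<in> co_esd n. card T = m}"
  let ?f = "insert (n + 4)"
  let ?g = "\<lambda>T. insert (n + 4) (insert (n + 3) T)"
  let ?h = "\<lambda>T. insert (n + 4) (insert (n + 2) T)"
  have fin: "finite T" if "T \<in> co_esd j" for T j
    using co_esd_subset[OF that] finite_subset by blast
  have notin: "i \<notin> T" if "T \<in> co_esd j" "j \<le> i" for T i j
    using co_esd_subset[OF that(1)] that(2) by auto
  define A B C D where "A = ?E (n + 4) (m + 2)" and "B = ?f ` ?E (n + 2) (m + 1)"
    and "C = ?g ` ?E (n + 1) m" and "D = ?h ` ?E n m"
  note defs = A_def B_def C_def D_def
  have split: "?E (n + 5) (m + 2) = A \<union> B \<union> C \<union> D"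
  proof -
    have "card (?f T) = card T + 1" if "T \<in> co_esd (n + 2)" for T
      using fin[OF that] notin[OF that] by simp
    moreover have "card (?g T) = card T + 2" if "T \<in> co_esd (n + 1)" for T
      using fin[OF that] notin[OF that] by simp
    moreover have "card (?h T) = card T + 2" if "T \<in> co_esd n" for T
      using fin[OF that] notin[OF that] by simp
    ultimately show ?thesis
      unfolding co_esd_rec defs by auto
  qed
  have finE: "finite (?E j i)" for i j
    using finite_co_esd by simp
  have fin4: "finite A" "finite B" "finite C" "finite D"
    unfolding defs by (intro finE finite_imageI)+
  have "inj_on ?f (?E (n + 2) (m + 1))" "inj_on ?g (?E (n + 1) m)" "inj_on ?h (?E n m)"
    \<comment> \<open>One left inverse serves all three maps, since the old sets contain none of the
      three removed numbers.\<close>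
    by (rule inj_on_inverseI[where g = "\<lambda>T. T - {n + 2, n + 3, n + 4}"]; use notin in force)+
  then have cards: "card B = num_co_esd (n + 2) (m + 1)" "card C = num_co_esd (n + 1) m"
    "card D = num_co_esd n m"
    unfolding defs num_co_esd_def by (simp_all only: card_image)
  have "A \<subseteq> {T. n + 4 \<notin> T}" "B \<subseteq> {T. n + 4 \<in> T \<and> n + 3 \<notin> T \<and> n + 2 \<notin> T}"
    "C \<subseteq> {T. n + 4 \<in> T \<and> n + 3 \<in> T}" "D \<subseteq> {T. n + 4 \<in> T \<and> n + 3 \<notin> T \<and> n + 2 \<in> T}"
    unfolding defs using notin by auto
  then have disj: "A \<inter> B = {}" "(A \<union> B) \<inter> C = {}" "(A \<union> B \<union> C) \<inter> D = {}"
    by blast+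
  have "num_co_esd (n + 5) (m + 2) = card (A \<union> B \<union> C \<union> D)"
    by (simp only: num_co_esd_def split)
  also have "\<dots> = card A + card B + card C + card D"
    using disj fin4 by (simp add: card_Un_disjoint)
  finally show ?thesis
    unfolding cards by (simp only: A_def num_co_esd_def)
qed

section \<open>Evaluation at the largest attainable number of ones\<close>

lemma num_co_esd_0: "num_co_esd n 0 = 1"
proof -
  have "{T \<in> co_esd n. card T = 0} = {{}}"
    using finite_subset[OF co_esd_subset] by (auto simp: co_esd_def)
  then show ?thesis
    by (simp add: num_co_esd_def)
qed

lemma card_co_esd_le:
  assumes "T \<in> co_esd n"
  shows "card T \<le> n - 2"
  using card_mono[OF _ co_esd_subset[OF assms]] by simp

text \<open>In every tile at most half of the positions are ones. The recurrence passes the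
  inequality on to each of its four terms.\<close>

lemma num_co_esd_eq_0:
  assumes "n < 2 * m"
  shows "num_co_esd n m = 0"
  using assms
proof (induction n arbitrary: m rule: less_induct)
  case (less n)
  show ?case
  proof (cases "n \<le> 4")
    case True
    \<comment> \<open>For \<open>n \<le> 4\<close> the bound \<open>n - 2\<close> is at most half of
      \<open>n\<close>, hence below \<open>m\<close>.\<close>
    then have "card T \<noteq> m" if "T \<in> co_esd n" for T
      using card_co_esd_le[OF that] less.prems by linarith
    then show ?thesis
      by (simp add: num_co_esd_eq_0_iff)
  next
    case False
    define j where "j = n - 5"
    define i where "i = m - 2"
    have j: "n = j + 5" and i: "m = i + 2"
      using False less.prems by (simp_all add: j_def i_def)
    show ?thesis
      unfolding j i num_co_esd_rec using less.IH less.prems j i by simp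
  qed
qed

lemma num_co_esd_3_1: "num_co_esd 3 1 = 1"
proof -
  have "{T \<in> co_esd 3. card T = 1} = {{2}}"
    by (auto simp: co_esd_def card_1_singleton_iff)
  then show ?thesis
    by (simp add: num_co_esd_def)
qed

lemma num_co_esd_4_2: "num_co_esd 4 2 = 1"
proof -
  have "{2..<4} = {2, 3::nat}"
    by auto
  moreover have "T = {2, 3}" if "T \<subseteq> {2, 3}" "card T = 2" for T :: "nat set"
    using that by (intro card_subset_eq) auto
  ultimately have "{T \<in> co_esd 4. card T = 2} = {{2, 3}}"
    by (auto simp: co_esd_def)
  then show ?thesis
    by (simp add: num_co_esd_def)
qed

lemma num_co_esd_2_1: "num_co_esd 2 1 = 0"
  using card_co_esd_le[of _ 2] by (auto simp: num_co_esd_eq_0_iff)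

text \<open>Exactly half of the positions are ones, so every tile is 0110. The recurrence starts at
  length 5, hence the separate treatment of length 4.\<close>

lemma num_co_esd_4k: "num_co_esd (4 * k) (2 * k) = 1"
proof (induction k)
  case 0
  then show ?case by (simp add: num_co_esd_0)
next
  case (Suc k)
  show ?case
  proof (cases k)
    case 0
    then show ?thesis by (simp add: num_co_esd_4_2)
  next
    case (Suc j)
    then show ?thesis
      using num_co_esd_rec[of "4 * j + 3" "2 * j + 2"] Suc.IH
      by (simp add: num_co_esd_eq_0 algebra_simps)
  qed
qed

text \<open>Half of the positions being ones would force all tiles to be 0110, but 4 does not divide
  the length. So in this residue class the maximum drops below \<open>n div 2\<close>.\<close>

lemma num_co_esd_4k2_max: "num_co_esd (4 * k + 2) (2 * k + 1) = 0"
proof (induction k)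
  case 0
  then show ?case using num_co_esd_2_1 by (simp add: eval_nat_numeral)
next
  case (Suc k)
  then show ?case
    using num_co_esd_rec[of "4 * k + 1" "2 * k + 1"] by (simp add: num_co_esd_eq_0 eval_nat_numeral)
qed

text \<open>Exactly one tile differs from 0110. Modulo 4 it must be 0, with \<open>k + 1\<close>
  places, or 01010, with \<open>k\<close> places.\<close>

lemma num_co_esd_4k1: "num_co_esd (4 * k + 1) (2 * k) = 2 * k + 1"
proof (induction k)
  case 0
  then show ?case by (simp add: num_co_esd_0)
next
  case (Suc k)
  then show ?case
    using num_co_esd_rec[of "4 * k" "2 * k"] num_co_esd_4k[of k] num_co_esd_4k[of "Suc k"]
      num_co_esd_4k2_max[of k] by (simp add: eval_nat_numeral)
qed

text \<open>The one tile that differs from 0110 must be 010, with \<open>k + 1\<close> places among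
  \<open>k\<close> copies of 0110.\<close>

lemma num_co_esd_4k3: "num_co_esd (4 * k + 3) (2 * k + 1) = k + 1"
proof (induction k)
  case 0
  then show ?case using num_co_esd_3_1 by simp
next
  case (Suc k)
  then show ?case
    using num_co_esd_rec[of "4 * k + 2" "2 * k + 1"] num_co_esd_4k[of "Suc k"]
      num_co_esd_4k2_max[of k] num_co_esd_4k2_max[of "Suc k"]
    by (simp add: eval_nat_numeral)
qed

text \<open>Two tiles differ from 0110: both are 010, or each is 0 or 01010. By the recurrence the
  count grows by \<open>5 * k + 5\<close> from \<open>k\<close> to \<open>k + 1\<close>. The factor
  2 avoids division in the naturals.\<close>

lemma num_co_esd_4k2: "2 * num_co_esd (4 * k + 2) (2 * k) = 5 * k ^ 2 + 5 * k + 2"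
proof (induction k)
  case 0
  then show ?case by (simp add: num_co_esd_0)
next
  case (Suc k)
  then show ?case
    using num_co_esd_rec[of "4 * k + 1" "2 * k"] num_co_esd_4k1[of k] num_co_esd_4k1[of "Suc k"]
      num_co_esd_4k3[of k] by (simp add: eval_nat_numeral)
qed

theorem theorem8p3:
  fixes n k :: nat
  assumes "n \<ge> 2"
  shows "(n = 4 * k \<longrightarrow> num_min_end_super_dominating (path_graph n) = 1) \<and>
    (n = 4 * k + 1 \<longrightarrow> num_min_end_super_dominating (path_graph n) = 2 * k + 1) \<and>
    (n = 4 * k + 2 \<longrightarrow>
       real (num_min_end_super_dominating (path_graph n)) = (5 * real k ^ 2 + 5 * real k + 2) / 2) \<and>
    (n = 4 * k + 3 \<longrightarrow> num_min_end_super_dominating (path_graph n) = k + 1)"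
proof (intro conjI impI)
  assume "n = 4 * k"
  then show "num_min_end_super_dominating (path_graph n) = 1"
    using num_min_esd_path_graph_eq[of n "2 * k"]
    by (simp add: num_co_esd_4k num_co_esd_eq_0)
next
  assume "n = 4 * k + 1"
  then show "num_min_end_super_dominating (path_graph n) = 2 * k + 1"
    using num_min_esd_path_graph_eq[of n "2 * k"] num_co_esd_4k1[of k]
    by (simp add: num_co_esd_eq_0)
next
  assume n: "n = 4 * k + 2"
  \<comment> \<open>The general bound leaves only \<open>m = 2 * k + 1\<close>, which the
    divisibility obstruction excludes.\<close>
  have "num_co_esd n m = 0" if "m > 2 * k" for m
    using that num_co_esd_4k2_max[of k] num_co_esd_eq_0[of n m] n
    by (cases "m = 2 * k + 1") auto
  moreover have "num_co_esd n (2 * k) > 0"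
    using num_co_esd_4k2[of k] n by (intro gr0I) simp
  ultimately have "2 * num_min_end_super_dominating (path_graph n) = 5 * k ^ 2 + 5 * k + 2"
    using num_min_esd_path_graph_eq[of n "2 * k"] num_co_esd_4k2[of k] n by simp
  then have "real (2 * num_min_end_super_dominating (path_graph n)) = real (5 * k ^ 2 + 5 * k + 2)"
    by (rule arg_cong)
  then show "real (num_min_end_super_dominating (path_graph n))
      = (5 * real k ^ 2 + 5 * real k + 2) / 2"
    by simp
next
  assume "n = 4 * k + 3"
  then show "num_min_end_super_dominating (path_graph n) = k + 1"
    using num_min_esd_path_graph_eq[of n "2 * k + 1"] num_co_esd_4k3[of k]
    by (simp add: num_co_esd_eq_0)
qed

end
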